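(* For every indexed forest $F$, the following identity holds in the formal power series ring $\mathbb{Q}[[x_1,x_2,\dots]]$: $$\mathfrak{P}_F=\sum_{L}(-1)^{|L|}\sum_{\kappa\ L\text{-compatible}}\ \prod_{v\in\operatorname{IN}(F)}x_{\kappa(v)},$$ where $L$ ranges over all lower order ideals of $\operatorname{IN}(F)$ and $\kappa$ over all $L$-compatible labelings $\kappa:\operatorname{IN}(F)\to\mathbb{Z}_{>0}$.
   Context: An indexed forest $F$ with finite support $S\subset\mathbb{Z}$ (maximal consecutive blocks $I_1<\cdots<I_k$) consists of plane binary trees $T_j$ with $|I_j|$ nodes, canonically labeled by the elements of $I_j$ in inorder. Missing children are leaves. $\operatorname{IN}(F)$ is the set of nodes. $\rho_F(v)$ is the canonical label of the node reached from $v$ by following left children as long as possible. The forest polynomial is $\mathfrak{P}_F=\sum_\kappa\prod_vx_{\kappa(v)}$ over $\kappa:\operatorname{IN}(F)\to\mathbb{Z}_{\ge1}$ with $\kappa(v)\le\rho_F(v)$, $\kappa(\text{left child of }u)\ge\kappa(u)$, and $\kappa(\text{right child of }u)>\kappa(u)$; it is $1$ for the empty forest. $\operatorname{IN}(F)$ is a poset in which each node is greater than its children (roots are maximal). A lower order ideal $L$ is a subset closed under taking children; let $U=\operatorname{IN}(F)\setminus L$. A labeling $\kappa:\operatorname{IN}(F)\to\mathbb{Z}_{>0}$ is $L$-compatible if the following hold. (1) For every edge with both endpoints $u$ (parent) and $v$ (child) in $U$: $\kappa(v)\ge\kappa(u)$ if $v$ is a left child and $\kappa(v)>\kappa(u)$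 if $v$ is a right child. (2) For every edge with both endpoints in $L$: $\kappa(v)<\kappa(u)$ if $v$ is a left child and $\kappa(v)\le\kappa(u)$ if $v$ is a right child. (3) $\kappa(v)>\rho_F(v)$ for every $v\in L$. No condition is imposed on edges joining $L$ and $U$. *)

theory Defs
  imports
    Complex_Main
    "HOL-Library.Multiset"
    "HOL-Library.FuncSet"
    "HOL-Library.Tree"
begin

section \<open>Formal power series in arbitrarily many variables\<close>

text \<open>
  The ring \<open>R[[x_i : i \<in> I]]\<close>, with the type \<open>'i\<close> as index set: arbitrary functions from
  monomials to coefficients.  A monomial is the finite multiset of the indices of its factors.
\<close>

typedef ('i, 'a) mfps = "UNIV :: ('i multiset \<Rightarrow> 'a) set"
  morphisms mcoeff Abs_mfps
  by simp

setup_lifting type_definition_mfps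

lemma mfps_eqI: "(\<And>m. mcoeff f m = mcoeff g m) \<Longrightarrow> f = g"
  by (metis ext mcoeff_inject)

lemma finite_submultisets: "finite {a. a \<subseteq># m}"
proof (induction m)
  case empty
  then show ?case by simp
next
  case (add x m)
  have "{a. a \<subseteq># add_mset x m} \<subseteq> {a. a \<subseteq># m} \<union> add_mset x ` {a. a \<subseteq># m}"
  proof
    fix a assume a: "a \<in> {a. a \<subseteq># add_mset x m}"
    show "a \<in> {a. a \<subseteq># m} \<union> add_mset x ` {a. a \<subseteq># m}"
    proof (cases "x \<in># a")
      case True
      then obtain b where "a = add_mset x b" by (metis multi_member_split)
      with a show ?thesis by auto
    next
      case False
      with a show ?thesis
        by (metis (no_types, lifting) UnI1 add_mset_remove_trivial diff_single_trivial
            mem_Collect_eq mset_subset_eq_add_mset_cancel subset_eq_diff_conv add_mset_add_single)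
    qed
  qed
  with add show ?case by (meson finite_UnI finite_imageI finite_subset)
qed

lemma finite_monomial_splittings: "finite {(a, b). a + b = (m :: 'i multiset)}"
  by (rule finite_subset[of _ "{a. a \<subseteq># m} \<times> {a. a \<subseteq># m}"])
     (auto simp: finite_submultisets)

instantiation mfps :: (type, comm_ring_1) comm_ring_1
begin

lift_definition zero_mfps :: "('a, 'b) mfps" is "\<lambda>_. 0" .
lift_definition one_mfps :: "('a, 'b) mfps" is "\<lambda>m. if m = {#} then 1 else 0" .
lift_definition plus_mfps :: "('a, 'b) mfps \<Rightarrow> ('a, 'b) mfps \<Rightarrow> ('a, 'b) mfps"
  is "\<lambda>f g m. f m + g m" .
lift_definition minus_mfps :: "('a, 'b) mfps \<Rightarrow> ('a, 'b) mfps \<Rightarrow> ('a, 'b) mfps"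
  is "\<lambda>f g m. f m - g m" .
lift_definition uminus_mfps :: "('a, 'b) mfps \<Rightarrow> ('a, 'b) mfps"
  is "\<lambda>f m. - f m" .
lift_definition times_mfps :: "('a, 'b) mfps \<Rightarrow> ('a, 'b) mfps \<Rightarrow> ('a, 'b) mfps"
  is "\<lambda>f g m. \<Sum>(a, b) | a + b = m. f a * g b" .

instance
proof
  fix f g h :: "('a, 'b) mfps"
  show "f * g * h = f * (g * h)"
  proof (rule mfps_eqI)
    fix m
    have "mcoeff (f * g * h) m =
        (\<Sum>(p, c) | p + c = m. \<Sum>(a, b) | a + b = p. mcoeff f a * mcoeff g b * mcoeff h c)"
      by (simp add: times_mfps.rep_eq sum_distrib_right case_prod_unfold)
    also have "\<dots> = (\<Sum>((p, c), (a, b)) \<in> (SIGMA (p, c) : {(p, c). p + c = m}. {(a, b). a + b = p}).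
        mcoeff f a * mcoeff g b * mcoeff h c)"
      by (subst sum.Sigma[symmetric])
         (auto simp: finite_monomial_splittings case_prod_unfold
           intro!: finite_monomial_splittings[unfolded case_prod_unfold])
    also have "\<dots> = (\<Sum>((a, q), (b, c)) \<in> (SIGMA (a, q) : {(a, q). a + q = m}. {(b, c). b + c = q}).
        mcoeff f a * (mcoeff g b * mcoeff h c))"
      by (rule sum.reindex_bij_witness
            [where i = "\<lambda>((a, q), (b, c)). ((a + b, c), (a, b))"
               and j = "\<lambda>((p, c), (a, b)). ((a, b + c), (b, c))"])
         (auto simp: add_ac mult_ac)
    also have "\<dots> =
        (\<Sum>(a, q) | a + q = m. \<Sum>(b, c) | b + c = q. mcoeff f a * (mcoeff g b * mcoeff h c))"
      by (subst sum.Sigma[symmetric])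
         (auto simp: finite_monomial_splittings case_prod_unfold
           intro!: finite_monomial_splittings[unfolded case_prod_unfold])
    also have "\<dots> = mcoeff (f * (g * h)) m"
      by (simp add: times_mfps.rep_eq sum_distrib_left case_prod_unfold)
    finally show "mcoeff (f * g * h) m = mcoeff (f * (g * h)) m" .
  qed
  show "f * g = g * f"
    by (rule mfps_eqI, unfold times_mfps.rep_eq,
        rule sum.reindex_bij_witness[where i = prod.swap and j = prod.swap])
       (auto simp: add_ac mult_ac)
  show "1 * f = f"
  proof (rule mfps_eqI)
    fix m
    have "mcoeff (1 * f) m = (\<Sum>(a, b) \<in> {({#}, m)}. mcoeff f (a + b))"
      unfolding times_mfps.rep_eq one_mfps.rep_eq
      by (rule sum.mono_neutral_cong_right) (auto simp: finite_monomial_splittings split: if_splits)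
    then show "mcoeff (1 * f) m = mcoeff f m" by simp
  qed
  show "(f + g) * h = f * h + g * h"
    by (rule mfps_eqI)
       (simp add: times_mfps.rep_eq plus_mfps.rep_eq case_prod_unfold distrib_right sum.distrib)
  show "(0 :: ('a, 'b) mfps) \<noteq> 1"
  proof
    assume "(0 :: ('a, 'b) mfps) = 1"
    then have "mcoeff (0 :: ('a, 'b) mfps) {#} = mcoeff (1 :: ('a, 'b) mfps) {#}" by simp
    then show False by (simp add: zero_mfps.rep_eq one_mfps.rep_eq)
  qed
  show "f + g + h = f + (g + h)"
    by (rule mfps_eqI) (simp add: plus_mfps.rep_eq add.assoc)
  show "f + g = g + f"
    by (rule mfps_eqI) (simp add: plus_mfps.rep_eq add.commute)
  show "0 + f = f"
    by (rule mfps_eqI) (simp add: plus_mfps.rep_eq zero_mfps.rep_eq)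
  show "- f + f = 0"
    by (rule mfps_eqI) (simp add: plus_mfps.rep_eq zero_mfps.rep_eq uminus_mfps.rep_eq)
  show "f - g = f + - g"
    by (rule mfps_eqI) (simp add: plus_mfps.rep_eq minus_mfps.rep_eq uminus_mfps.rep_eq)
qed

end

lift_definition mfps_var :: "'i \<Rightarrow> ('i, 'a :: comm_ring_1) mfps"
  is "\<lambda>i m. if m = {#i#} then 1 else 0" .

text \<open>
  Infinite sums are taken coefficientwise; this is meaningful for families in which each monomial
  occurs in only finitely many members.
\<close>

definition formally_summable :: "('k \<Rightarrow> ('i, 'a :: comm_ring_1) mfps) \<Rightarrow> 'k set \<Rightarrow> bool" where
  "formally_summable f A \<longleftrightarrow> (\<forall>m. finite {k \<in> A. mcoeff (f k) m \<noteq> 0})"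

definition formal_sum :: "('k \<Rightarrow> ('i, 'a :: comm_ring_1) mfps) \<Rightarrow> 'k set \<Rightarrow> ('i, 'a) mfps" where
  "formal_sum f A = Abs_mfps (\<lambda>m. \<Sum>k \<in> {k \<in> A. mcoeff (f k) m \<noteq> 0}. mcoeff (f k) m)"

lemma mcoeff_prod_var:
  assumes "finite V"
  shows "mcoeff (\<Prod>v \<in> V. mfps_var (\<kappa> v) :: ('i, 'a :: comm_ring_1) mfps) m =
    (if m = image_mset \<kappa> (mset_set V) then 1 else 0)"
  using assms
proof (induction V arbitrary: m rule: finite_induct)
  case empty
  then show ?case by (simp add: one_mfps.rep_eq)
next
  case (insert v V)
  let ?n = "image_mset \<kappa> (mset_set V)"
  have "mcoeff (\<Prod>v \<in> insert v V. mfps_var (\<kappa> v) :: ('i, 'a) mfps) m =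
      (\<Sum>(a, b) | a + b = m. if (a, b) = ({#\<kappa> v#}, ?n) then 1 else 0)"
    using insert by (auto simp: times_mfps.rep_eq mfps_var.rep_eq intro!: sum.cong)
  also have "\<dots> = (\<Sum>p \<in> {(a, b). a + b = m}. if p = ({#\<kappa> v#}, ?n) then 1 else 0)"
    by (intro sum.cong) (auto split: if_splits)
  also have "\<dots> = (if ({#\<kappa> v#}, ?n) \<in> {(a, b). a + b = m} then 1 else 0)"
    by (simp add: sum.delta' sum.delta finite_monomial_splittings)
  also have "\<dots> = (if m = image_mset \<kappa> (mset_set (insert v V)) then 1 else 0)"
    using insert by auto
  finally show ?case .
qed

lemma formally_summable_labelings:
  assumes "finite V" and "K \<subseteq> V \<rightarrow>\<^sub>E A"
  shows "formally_summable
    (\<lambda>\<kappa>. \<Prod>v \<in> V. mfps_var (\<kappa> v) :: ('i, 'a :: comm_ring_1) mfps) K"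
  unfolding formally_summable_def
proof
  fix m :: "'i multiset"
  have "{\<kappa> \<in> K. mcoeff (\<Prod>v \<in> V. mfps_var (\<kappa> v) :: ('i, 'a) mfps) m \<noteq> 0}
      \<subseteq> V \<rightarrow>\<^sub>E set_mset m"
    using assms by (auto simp: mcoeff_prod_var PiE_iff subset_iff split: if_splits)
  then show "finite {\<kappa> \<in> K. mcoeff (\<Prod>v \<in> V. mfps_var (\<kappa> v) :: ('i, 'a) mfps) m \<noteq> 0}"
    by (rule finite_subset) (simp add: finite_PiE assms)
qed


section \<open>Indexed forests\<close>

text \<open>Maximal sets of consecutive integers in \<open>S\<close>.\<close>

definition blocks :: "int set \<Rightarrow> int set set" where
  "blocks S = {{a..b} | a b. a \<le> b \<and> {a..b} \<subseteq> S \<and> a - 1 \<notin> S \<and> b + 1 \<notin> S}"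

text \<open>
  An indexed forest is the list \<open>T_1, \<dots>, T_k\<close> of its trees, ordered by support.  Each node
  carries its canonical label, which also serves as its identity; \<open>Leaf\<close> is a missing child.
\<close>

definition indexed_forest :: "int set \<Rightarrow> int tree list \<Rightarrow> bool" where
  "indexed_forest S F \<longleftrightarrow>
     finite S \<and>
     set_tree ` set F = blocks S \<and>
     (\<forall>t \<in> set F. sorted_wrt (<) (inorder t)) \<and>
     sorted_wrt (\<lambda>s t. \<forall>a \<in> set_tree s. \<forall>b \<in> set_tree t. a < b) F"

definition IN :: "int tree list \<Rightarrow> int set" where
  "IN F = (\<Union>t \<in> set F. set_tree t)"

text \<open>\<open>left_child F v u\<close>: \<open>v\<close> is the left child of \<open>u\<close>; likewise for \<open>right_child\<close>.\<close>

definition left_child :: "int tree list \<Rightarrow> int \<Rightarrow> int \<Rightarrow> bool" where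
  "left_child F v u \<longleftrightarrow> (\<exists>t \<in> set F. \<exists>l r r'. \<langle>\<langle>l, v, r\<rangle>, u, r'\<rangle> \<in> subtrees t)"

definition right_child :: "int tree list \<Rightarrow> int \<Rightarrow> int \<Rightarrow> bool" where
  "right_child F v u \<longleftrightarrow> (\<exists>t \<in> set F. \<exists>l' l r. \<langle>l', u, \<langle>l, v, r\<rangle>\<rangle> \<in> subtrees t)"

definition rho :: "int tree list \<Rightarrow> int \<Rightarrow> int" where
  "rho F v = (THE w. (left_child F)\<^sup>*\<^sup>* w v \<and> (\<nexists>u. left_child F u w))"

lemma finite_IN: "finite (IN F)"
  by (simp add: IN_def)

lemma Union_blocks:
  assumes "finite S"
  shows "\<Union> (blocks S) = S"
proof
  show "\<Union> (blocks S) \<subseteq> S" by (auto simp: blocks_def)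
  show "S \<subseteq> \<Union> (blocks S)"
  proof
    fix x assume x: "x \<in> S"
    let ?B = "{y. x \<le> y \<and> {x..y} \<subseteq> S}" and ?A = "{y. y \<le> x \<and> {y..x} \<subseteq> S}"
    define a b where "a = Min ?A" and "b = Max ?B"
    have fin: "finite ?A" "finite ?B"
      by (rule finite_subset[OF _ assms]; use atLeastAtMost_iff in blast)+
    have mem: "x \<in> ?A" "x \<in> ?B" using x by auto
    have a: "a \<in> ?A" unfolding a_def using Min_in[OF fin(1)] mem by blast
    have b: "b \<in> ?B" unfolding b_def using Max_in[OF fin(2)] mem by blast
    have "a - 1 \<notin> S"
    proof
      assume "a - 1 \<in> S"
      moreover have "{a - 1..x} = insert (a - 1) {a..x}" using a by auto
      ultimately have "a - 1 \<in> ?A" using a by auto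
      then show False using Min_le[OF fin(1)] unfolding a_def by fastforce
    qed
    moreover have "b + 1 \<notin> S"
    proof
      assume "b + 1 \<in> S"
      moreover have "{x..b + 1} = insert (b + 1) {x..b}" using b by auto
      ultimately have "b + 1 \<in> ?B" using b by auto
      then show False using Max_ge[OF fin(2)] unfolding b_def by fastforce
    qed
    moreover have "{a..b} \<subseteq> S"
    proof -
      have "{a..b} = {a..x} \<union> {x..b}" using a b by auto
      then show ?thesis using a b by simp
    qed
    moreover have "a \<le> b" using a b by simp
    ultimately have "{a..b} \<in> blocks S"
      unfolding blocks_def by (intro CollectI exI[of _ a] exI[of _ b] conjI refl)
    then show "x \<in> \<Union> (blocks S)" using a b by (intro UnionI[of "{a..b}"]) auto
  qed
qed

lemma IN_eq_support: "indexed_forest S F \<Longrightarrow> IN F = S"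
  using Union_blocks by (simp add: indexed_forest_def IN_def)

lemma subtrees_eq_if_distinct:
  assumes "distinct (inorder t)" "\<langle>l, a, r\<rangle> \<in> subtrees t" "\<langle>l', a, r'\<rangle> \<in> subtrees t"
  shows "l = l' \<and> r = r'"
  using assms by (induction t) (auto dest: in_set_tree_if)

lemma indexed_forest_node_unique:
  assumes F: "indexed_forest S F" and st: "s \<in> set F" "t \<in> set F"
    and sub: "\<langle>l, a, r\<rangle> \<in> subtrees s" "\<langle>l', a, r'\<rangle> \<in> subtrees t"
  shows "l = l' \<and> r = r'"
proof -
  from st obtain i j where ij: "i < length F" "j < length F" "s = F ! i" "t = F ! j"
    by (metis in_set_conv_nth)
  have a: "a \<in> set_tree s" "a \<in> set_tree t" using sub by (auto dest: in_set_tree_if)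
  have "i = j"
  proof (rule ccontr)
    assume "i \<noteq> j"
    then consider "i < j" | "j < i" by linarith
    then show False
      using F a ij unfolding indexed_forest_def sorted_wrt_iff_nth_less by cases blast+
  qed
  moreover have "distinct (inorder t)"
    using F st unfolding indexed_forest_def by (auto simp: strict_sorted_iff)
  ultimately show ?thesis using subtrees_eq_if_distinct sub ij by metis
qed

lemma rho_unique:
  assumes F: "indexed_forest S F" and v: "v \<in> IN F"
  shows "\<exists>!w. (left_child F)\<^sup>*\<^sup>* w v \<and> (\<nexists>u. left_child F u w)"
proof -
  have det: "w = w'" if "left_child F w u" "left_child F w' u" for w w' u
    using that indexed_forest_node_unique[OF F] unfolding left_child_def by blast
  from v obtain t l r where t: "t \<in> set F" "\<langle>l, v, r\<rangle> \<in> subtrees t"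
    unfolding IN_def using set_treeE by fastforce
  from t(2) show ?thesis
  proof (induction l arbitrary: v r)
    case Leaf
    have "\<nexists>u. left_child F u v"
      using indexed_forest_node_unique[OF F t(1) _ Leaf] unfolding left_child_def by blast
    then show ?case by (metis rtranclp.cases rtranclp.rtrancl_refl)
  next
    case (Node l' w r')
    have w: "left_child F w v" using Node.prems t(1) unfolding left_child_def by blast
    have "\<langle>l', w, r'\<rangle> \<in> subtrees t"
    proof -
      have "s \<in> subtrees x \<Longrightarrow> s' \<in> subtrees s \<Longrightarrow> s' \<in> subtrees x" for s s' x :: "int tree"
        by (induction x) auto
      moreover have "\<langle>l', w, r'\<rangle> \<in> subtrees \<langle>\<langle>l', w, r'\<rangle>, v, r\<rangle>" by simp
      ultimately show ?thesis using Node.prems by blast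
    qed
    note IH = Node.IH(1)[OF this]
    have step: "(left_child F)\<^sup>*\<^sup>* x v \<and> (\<nexists>u. left_child F u x) \<longleftrightarrow>
        (left_child F)\<^sup>*\<^sup>* x w \<and> (\<nexists>u. left_child F u x)" for x
      using w det by (metis rtranclp.simps)
    show ?case using IH unfolding step .
  qed
qed


section \<open>Forest polynomials and compatible labelings\<close>

definition forest_labelings :: "int tree list \<Rightarrow> (int \<Rightarrow> nat) set" where
  "forest_labelings F = {\<kappa> \<in> IN F \<rightarrow>\<^sub>E {1..}.
     (\<forall>v \<in> IN F. int (\<kappa> v) \<le> rho F v) \<and>
     (\<forall>u v. left_child F v u \<longrightarrow> \<kappa> v \<ge> \<kappa> u) \<and>
     (\<forall>u v. right_child F v u \<longrightarrow> \<kappa> v > \<kappa> u)}"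

lemma finite_forest_labelings: "finite (forest_labelings F)"
proof (rule finite_subset)
  show "forest_labelings F \<subseteq> (\<Pi>\<^sub>E v \<in> IN F. {..nat (rho F v)})"
  proof
    fix \<kappa> assume "\<kappa> \<in> forest_labelings F"
    then have ext: "\<kappa> \<in> extensional (IN F)" and le: "\<And>v. v \<in> IN F \<Longrightarrow> int (\<kappa> v) \<le> rho F v"
      by (simp_all add: forest_labelings_def PiE_iff)
    have "\<kappa> v \<in> {..nat (rho F v)}" if "v \<in> IN F" for v
      using le[OF that] by simp
    with ext show "\<kappa> \<in> (\<Pi>\<^sub>E v \<in> IN F. {..nat (rho F v)})"
      by (simp add: PiE_iff)
  qed
qed (simp add: finite_PiE finite_IN)

text \<open>
  Variables are indexed by \<open>nat\<close>, but labels are positive, so the variable of index \<open>0\<close> never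
  occurs: everything below lives in the subring \<open>Q[[x_1, x_2, \<dots>]]\<close>.
\<close>

definition forest_polynomial :: "int tree list \<Rightarrow> (nat, rat) mfps" where
  "forest_polynomial F = (\<Sum>\<kappa> \<in> forest_labelings F. \<Prod>v \<in> IN F. mfps_var (\<kappa> v))"

definition lower_order_ideal :: "int tree list \<Rightarrow> int set \<Rightarrow> bool" where
  "lower_order_ideal F L \<longleftrightarrow>
     L \<subseteq> IN F \<and> (\<forall>u \<in> L. \<forall>v. left_child F v u \<or> right_child F v u \<longrightarrow> v \<in> L)"

lemma finite_lower_order_ideals: "finite {L. lower_order_ideal F L}"
  by (rule finite_subset[of _ "Pow (IN F)"]) (auto simp: lower_order_ideal_def finite_IN)

definition compatible_labelings :: "int tree list \<Rightarrow> int set \<Rightarrow> (int \<Rightarrow> nat) set" where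
  "compatible_labelings F L = {\<kappa> \<in> IN F \<rightarrow>\<^sub>E {1..}.
     (\<forall>u \<in> IN F - L. \<forall>v \<in> IN F - L.
        (left_child F v u \<longrightarrow> \<kappa> v \<ge> \<kappa> u) \<and> (right_child F v u \<longrightarrow> \<kappa> v > \<kappa> u)) \<and>
     (\<forall>u \<in> L. \<forall>v \<in> L.
        (left_child F v u \<longrightarrow> \<kappa> v < \<kappa> u) \<and> (right_child F v u \<longrightarrow> \<kappa> v \<le> \<kappa> u)) \<and>
     (\<forall>v \<in> L. int (\<kappa> v) > rho F v)}"

lemma formally_summable_compatible_labelings:
  "formally_summable (\<lambda>\<kappa>. \<Prod>v \<in> IN F. mfps_var (\<kappa> v) :: (nat, rat) mfps)
     (compatible_labelings F L)"
  by (rule formally_summable_labelings[where A = "{1..}"])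
     (auto simp: finite_IN compatible_labelings_def)

end

theory Submission
  imports Defs
begin

text \<open>
  The identity already holds for each labeling \<open>\<kappa>\<close> separately: the signed number of ideals \<open>L\<close> for
  which \<open>\<kappa>\<close> is \<open>L\<close>-compatible is \<open>1\<close> if \<open>\<kappa>\<close> is a forest labeling and \<open>0\<close> otherwise.  The conditions
  on an edge inside \<open>U\<close> and inside \<open>L\<close> are complementary, so for fixed \<open>\<kappa>\<close> every edge is of exactly
  one of the two types.  The signed count is multiplicative over the trees of the forest, and on a
  single tree it is computed by induction: either the root lies in \<open>L\<close>, and \<open>L\<close> is the whole tree, or
  the two subtrees contribute independently, and a child joined to the root by an edge of the second
  type must lie in \<open>L\<close>.  The mixed cases vanish because the label of the root of a tree contained
  in \<open>L\<close> exceeds every canonical label of that tree.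
\<close>

section \<open>Signed sums over subsets\<close>

text \<open>Summing over all subsets, with the ideal condition moved into \<open>P\<close>, makes
  the sum factor over disjoint node sets.\<close>

definition signed_sum :: "'a set \<Rightarrow> ('a set \<Rightarrow> bool) \<Rightarrow> rat" where
  "signed_sum A P = (\<Sum>L\<in>Pow A. of_bool (P L) * (-1) ^ card L)"

lemma signed_sum_cong:
  "A = B \<Longrightarrow> (\<And>L. L \<subseteq> A \<Longrightarrow> P L = Q L) \<Longrightarrow> signed_sum A P = signed_sum B Q"
  unfolding signed_sum_def by (intro sum.cong) auto

text \<open>A subset of the disjoint union is a pair of traces on \<open>A\<close> and
  \<open>B\<close>; cardinalities add, so signs multiply.\<close>

lemma signed_sum_Un:
  assumes fin: "finite A" "finite B" and disj: "A \<inter> B = {}"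
  shows "signed_sum (A \<union> B) (\<lambda>L. P (L \<inter> A) \<and> Q (L \<inter> B)) = signed_sum A P * signed_sum B Q"
proof -
  have "signed_sum A P * signed_sum B Q =
      (\<Sum>(X, Y)\<in>Pow A \<times> Pow B. of_bool (P X) * (-1) ^ card X * (of_bool (Q Y) * (-1) ^ card Y))"
    by (simp add: signed_sum_def sum_product sum.cartesian_product)
  also have "\<dots> = signed_sum (A \<union> B) (\<lambda>L. P (L \<inter> A) \<and> Q (L \<inter> B))"
    unfolding signed_sum_def
  proof (rule sum.reindex_bij_witness
      [where i = "\<lambda>L. (L \<inter> A, L \<inter> B)" and j = "\<lambda>(X, Y). X \<union> Y"])
    fix p assume p: "p \<in> Pow A \<times> Pow B"
    obtain X Y where XY: "p = (X, Y)" "X \<subseteq> A" "Y \<subseteq> B" using p by auto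
    have eqs: "(X \<union> Y) \<inter> A = X" "(X \<union> Y) \<inter> B = Y" using XY disj by auto
    have "card (X \<union> Y) = card X + card Y"
      using XY fin disj by (intro card_Un_disjoint) (auto dest: finite_subset)
    then show "of_bool (P ((case p of (X, Y) \<Rightarrow> X \<union> Y) \<inter> A) \<and> Q ((case p of (X, Y) \<Rightarrow> X \<union> Y) \<inter> B)) *
        (- 1) ^ card (case p of (X, Y) \<Rightarrow> X \<union> Y) =
        (case p of (X, Y) \<Rightarrow> of_bool (P X) * (-1) ^ card X * (of_bool (Q Y) * (-1 :: rat) ^ card Y))"
      using XY eqs by (simp add: power_add of_bool_conj)
    show "(\<lambda>L. (L \<inter> A, L \<inter> B)) (case p of (X, Y) \<Rightarrow> X \<union> Y) = p"
      using XY eqs by simp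
  qed auto
  finally show ?thesis by simp
qed

text \<open>Adjoining \<open>a\<close> is a bijection onto the subsets containing it and flips the
  sign; \<open>a\<close> will be the root of a tree.\<close>

lemma signed_sum_insert:
  assumes "finite A" "a \<notin> A"
  shows "signed_sum (insert a A) P = signed_sum A P - signed_sum A (\<lambda>L. P (insert a L))"
proof -
  have card: "card (insert a L) = Suc (card L)" if "L \<in> Pow A" for L
    using that assms by (metis Pow_iff card_insert_disjoint finite_subset subsetD)
  have inj: "inj_on (insert a) (Pow A)"
    using assms(2) by (metis (no_types, lifting) PowD inj_onI insert_ident subsetD)
  have "signed_sum (insert a A) P =
      signed_sum A P + (\<Sum>L\<in>insert a ` Pow A. of_bool (P L) * (-1) ^ card L)"
    unfolding signed_sum_def Pow_insert using assms by (intro sum.union_disjoint) auto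
  also have "(\<Sum>L\<in>insert a ` Pow A. of_bool (P L) * (-1) ^ card L) =
      - signed_sum A (\<lambda>L. P (insert a L))"
    unfolding signed_sum_def sum_negf[symmetric] sum.reindex[OF inj]
    by (intro sum.cong) (auto simp: card)
  finally show ?thesis by simp
qed

lemma signed_sum_whole:
  assumes "finite A"
  shows "signed_sum A (\<lambda>L. L = A \<and> b) = of_bool b * (-1) ^ card A"
proof -
  have "signed_sum A (\<lambda>L. L = A \<and> b) = (\<Sum>L\<in>{A}. of_bool b * (-1) ^ card L)"
    unfolding signed_sum_def using assms by (intro sum.mono_neutral_cong_right) auto
  then show ?thesis by simp
qed

section \<open>Labelings of a single tree\<close>

text \<open>
  The first inorder label of a subtree is the value of \<open>\<rho>\<close> at its root.  The predicate \<open>good\<close> describes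
  forest labelings, \<open>compat\<close> states that \<open>L\<close> is an ideal and \<open>\<kappa>\<close> is \<open>L\<close>-compatible, and \<open>full\<close> is the
  case of \<open>compat\<close> where \<open>L\<close> is the whole tree.
\<close>

definition good_node :: "(int \<Rightarrow> nat) \<Rightarrow> int tree \<Rightarrow> int \<Rightarrow> int tree \<Rightarrow> bool" where
  "good_node \<kappa> l a r \<longleftrightarrow> int (\<kappa> a) \<le> hd (inorder \<langle>l, a, r\<rangle>) \<and>
     (l \<noteq> \<langle>\<rangle> \<longrightarrow> \<kappa> a \<le> \<kappa> (value l)) \<and> (r \<noteq> \<langle>\<rangle> \<longrightarrow> \<kappa> a < \<kappa> (value r))"

definition full_node :: "(int \<Rightarrow> nat) \<Rightarrow> int tree \<Rightarrow> int \<Rightarrow> int tree \<Rightarrow> bool" where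
  "full_node \<kappa> l a r \<longleftrightarrow> int (\<kappa> a) > hd (inorder \<langle>l, a, r\<rangle>) \<and>
     (l \<noteq> \<langle>\<rangle> \<longrightarrow> \<kappa> (value l) < \<kappa> a) \<and> (r \<noteq> \<langle>\<rangle> \<longrightarrow> \<kappa> (value r) \<le> \<kappa> a)"

text \<open>Asking each node of \<open>L\<close> to have its children in \<open>L\<close> makes the
  ideal condition local. The alternatives \<open>value l \<in> L\<close> and
  \<open>value r \<in> L\<close> in the other branch leave edges between \<open>L\<close> and its
  complement free.\<close>

definition compat_node :: "(int \<Rightarrow> nat) \<Rightarrow> int set \<Rightarrow> int tree \<Rightarrow> int \<Rightarrow> int tree \<Rightarrow> bool" where
  "compat_node \<kappa> L l a r \<longleftrightarrow>
     (if a \<in> L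
      then full_node \<kappa> l a r \<and> (l \<noteq> \<langle>\<rangle> \<longrightarrow> value l \<in> L) \<and> (r \<noteq> \<langle>\<rangle> \<longrightarrow> value r \<in> L)
      else (l \<noteq> \<langle>\<rangle> \<longrightarrow> value l \<in> L \<or> \<kappa> a \<le> \<kappa> (value l)) \<and>
           (r \<noteq> \<langle>\<rangle> \<longrightarrow> value r \<in> L \<or> \<kappa> a < \<kappa> (value r)))"

fun good :: "(int \<Rightarrow> nat) \<Rightarrow> int tree \<Rightarrow> bool" where
  "good \<kappa> \<langle>\<rangle> = True"
| "good \<kappa> \<langle>l, a, r\<rangle> = (good_node \<kappa> l a r \<and> good \<kappa> l \<and> good \<kappa> r)"

fun full :: "(int \<Rightarrow> nat) \<Rightarrow> int tree \<Rightarrow> bool" where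
  "full \<kappa> \<langle>\<rangle> = True"
| "full \<kappa> \<langle>l, a, r\<rangle> = (full_node \<kappa> l a r \<and> full \<kappa> l \<and> full \<kappa> r)"

fun compat :: "(int \<Rightarrow> nat) \<Rightarrow> int set \<Rightarrow> int tree \<Rightarrow> bool" where
  "compat \<kappa> L \<langle>\<rangle> = True"
| "compat \<kappa> L \<langle>l, a, r\<rangle> = (compat_node \<kappa> L l a r \<and> compat \<kappa> L l \<and> compat \<kappa> L r)"

section \<open>Locality of the node conditions, and ideals containing the root\<close>

lemma good_iff_subtrees: "good \<kappa> t \<longleftrightarrow> (\<forall>l a r. \<langle>l, a, r\<rangle> \<in> subtrees t \<longrightarrow> good_node \<kappa> l a r)"
  by (induction t) auto

lemma compat_iff_subtrees:
  "compat \<kappa> L t \<longleftrightarrow> (\<forall>l a r. \<langle>l, a, r\<rangle> \<in> subtrees t \<longrightarrow> compat_node \<kappa> L l a r)"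
  by (induction t) auto

lemma value_in_set_tree: "t \<noteq> \<langle>\<rangle> \<Longrightarrow> value t \<in> set_tree t"
  by (cases t) auto

text \<open>Only nodes of \<open>t\<close> are tested for membership, so disjoint trees can be
  treated independently.\<close>

lemma compat_Int: "set_tree t \<subseteq> A \<Longrightarrow> compat \<kappa> (L \<inter> A) t = compat \<kappa> L t"
proof (induction t)
  case (Node l a r)
  then show ?case
    using value_in_set_tree[of l] value_in_set_tree[of r] by (auto simp: compat_node_def)
qed simp

text \<open>Membership in \<open>L\<close> is inherited by children, so the first branch of
  \<open>compat_node\<close> applies at every node.\<close>

lemma compat_root:
  "compat \<kappa> L t \<Longrightarrow> t \<noteq> \<langle>\<rangle> \<Longrightarrow> value t \<in> L \<Longrightarrow> set_tree t \<subseteq> L \<and> full \<kappa> t"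
proof (induction t)
  case (Node l a r)
  then show ?case by (cases "l = \<langle>\<rangle>"; cases "r = \<langle>\<rangle>") (auto simp: compat_node_def)
qed simp

lemma compat_if_full: "full \<kappa> t \<Longrightarrow> set_tree t \<subseteq> L \<Longrightarrow> compat \<kappa> L t"
proof (induction t)
  case (Node l a r)
  then show ?case
    using value_in_set_tree[of l] value_in_set_tree[of r] by (auto simp: compat_node_def)
qed simp

text \<open>Serves to collapse a signed sum over ideals containing the root to a single
  term.\<close>

lemma compat_root_iff:
  assumes "t \<noteq> \<langle>\<rangle>" "L \<subseteq> set_tree t"
  shows "compat \<kappa> L t \<and> value t \<in> L \<longleftrightarrow> L = set_tree t \<and> full \<kappa> t"
  using assms compat_root[of \<kappa> L t] compat_if_full[of \<kappa> t L] value_in_set_tree[of t] by blast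

section \<open>Search trees on an interval, and bounds on root labels\<close>

lemma bst_interval_children:
  assumes "bst \<langle>l, x, r\<rangle>" "set_tree \<langle>l, x, r\<rangle> = {a..b :: int}"
  shows "set_tree l = {a..x - 1}" "set_tree r = {x + 1..b}"
proof -
  have lr: "\<forall>y\<in>set_tree l. y < x" "\<forall>y\<in>set_tree r. x < y" using assms(1) by auto
  have mem: "y \<in> {a..b} \<longleftrightarrow> y = x \<or> y \<in> set_tree l \<or> y \<in> set_tree r" for y
    unfolding assms(2)[symmetric] by auto
  have x: "a \<le> x" "x \<le> b" using mem[of x] by auto
  show "set_tree l = {a..x - 1}"
  proof (rule set_eqI)
    show "y \<in> set_tree l \<longleftrightarrow> y \<in> {a..x - 1}" for y
      using mem[of y] lr x(2) by (cases "y < x") auto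
  qed
  show "set_tree r = {x + 1..b}"
  proof (rule set_eqI)
    show "y \<in> set_tree r \<longleftrightarrow> y \<in> {x + 1..b}" for y
      using mem[of y] lr x(1) by (cases "x < y") auto
  qed
qed

lemma hd_inorder_Node: "hd (inorder \<langle>l, a, r\<rangle>) = (if l = \<langle>\<rangle> then a else hd (inorder l))"
  by (cases l) (auto simp: hd_append)

lemma bst_interval_hd_inorder:
  "bst t \<Longrightarrow> set_tree t = {a..b :: int} \<Longrightarrow> t \<noteq> \<langle>\<rangle> \<Longrightarrow> hd (inorder t) = a"
proof (induction t arbitrary: b)
  case (Node l x r)
  note ch = bst_interval_children[OF Node.prems(1,2)]
  show ?case
  proof (cases "l = \<langle>\<rangle>")
    case True
    then have "x \<le> a" using ch(1) by (auto simp: eq_set_tree_empty)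
    moreover have "x \<in> {a..b}" unfolding Node.prems(2)[symmetric] by simp
    ultimately show ?thesis using True by simp
  next
    case False
    then show ?thesis using Node.IH(1)[OF _ ch(1)] Node.prems(1) by (simp add: hd_inorder_Node)
  qed
qed simp

text \<open>\<open>full\<close> bounds labels only by the least canonical label of a subtree; the
  bound by the largest one comes from the edges. A right subtree has the same largest label
  \<open>b\<close>, and its root is labeled at most as high as the parent. With no right child,
  \<open>b\<close> is the root itself.\<close>

lemma full_root_gt:
  "full \<kappa> t \<Longrightarrow> bst t \<Longrightarrow> set_tree t = {a..b} \<Longrightarrow> t \<noteq> \<langle>\<rangle> \<Longrightarrow> b < int (\<kappa> (value t))"
proof (induction t arbitrary: a b)
  case (Node l x r)
  note ch = bst_interval_children[OF Node.prems(2,3)]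
  have x: "x \<in> {a..b}" unfolding Node.prems(3)[symmetric] by simp
  show ?case
  proof (cases "r = \<langle>\<rangle>")
    case False
    have "b < int (\<kappa> (value r))" using Node.IH(2)[OF _ _ ch(2) False] Node.prems by simp
    then show ?thesis using Node.prems(1) False by (simp add: full_node_def)
  next
    case True
    then have b: "b = x" using ch(2) x by auto
    show ?thesis
    proof (cases "l = \<langle>\<rangle>")
      case True
      then show ?thesis using Node.prems(1) b by (simp add: full_node_def)
    next
      case False
      \<comment> \<open>The left subtree ends at \<open>x - 1\<close>; the strict inequality on the
        left edge makes up the missing one.\<close>
      have "x - 1 < int (\<kappa> (value l))" using Node.IH(1)[OF _ _ ch(1) False] Node.prems by simp
      then show ?thesis using Node.prems(1) False b by (simp add: full_node_def)
    qed
  qed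
qed simp

lemma good_root_le: "good \<kappa> t \<Longrightarrow> t \<noteq> \<langle>\<rangle> \<Longrightarrow> int (\<kappa> (value t)) \<le> hd (inorder t)"
  by (cases t) (auto simp: good_node_def)

lemma full_root_gt_hd: "full \<kappa> t \<Longrightarrow> t \<noteq> \<langle>\<rangle> \<Longrightarrow> hd (inorder t) < int (\<kappa> (value t))"
  by (cases t) (auto simp: full_node_def)

text \<open>
  The parameter \<open>q\<close> says that the edge above \<open>t\<close> satisfies the condition imposed inside \<open>U\<close>.
\<close>

lemma signed_sum_child:
  assumes "signed_sum (set_tree t) (\<lambda>L. compat \<kappa> L t) = of_bool (good \<kappa> t)"
  shows "signed_sum (set_tree t) (\<lambda>L. compat \<kappa> L t \<and> (t \<noteq> \<langle>\<rangle> \<longrightarrow> value t \<in> L \<or> q)) =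
    (if t = \<langle>\<rangle> \<or> q then of_bool (good \<kappa> t) else of_bool (full \<kappa> t) * (-1) ^ card (set_tree t))"
proof (cases "t = \<langle>\<rangle> \<or> q")
  case True
  then have "signed_sum (set_tree t) (\<lambda>L. compat \<kappa> L t \<and> (t \<noteq> \<langle>\<rangle> \<longrightarrow> value t \<in> L \<or> q)) =
      signed_sum (set_tree t) (\<lambda>L. compat \<kappa> L t)"
    by (intro signed_sum_cong) auto
  then show ?thesis using True assms by simp
next
  case False
  \<comment> \<open>With \<open>q\<close> false the root is forced into \<open>L\<close>, so only
    the whole tree survives.\<close>
  then have "signed_sum (set_tree t) (\<lambda>L. compat \<kappa> L t \<and> (t \<noteq> \<langle>\<rangle> \<longrightarrow> value t \<in> L \<or> q)) =
      signed_sum (set_tree t) (\<lambda>L. L = set_tree t \<and> full \<kappa> t)"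
    using compat_root_iff[of t _ \<kappa>] by (intro signed_sum_cong) auto
  then show ?thesis using False by (simp add: signed_sum_whole)
qed

text \<open>Split by whether the root lies in \<open>L\<close>. If not, the subtrees contribute
  independently; if so, \<open>L\<close> is the whole tree, and the root accounts for the minus
  sign.\<close>

lemma signed_sum_Node:
  assumes "bst \<langle>l, x, r\<rangle>"
  shows "signed_sum (set_tree \<langle>l, x, r\<rangle>) (\<lambda>L. compat \<kappa> L \<langle>l, x, r\<rangle>) =
    signed_sum (set_tree l) (\<lambda>L. compat \<kappa> L l \<and> (l \<noteq> \<langle>\<rangle> \<longrightarrow> value l \<in> L \<or> \<kappa> x \<le> \<kappa> (value l))) *
    signed_sum (set_tree r) (\<lambda>L. compat \<kappa> L r \<and> (r \<noteq> \<langle>\<rangle> \<longrightarrow> value r \<in> L \<or> \<kappa> x < \<kappa> (value r))) -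
    of_bool (full \<kappa> \<langle>l, x, r\<rangle>) * (-1) ^ (card (set_tree l) + card (set_tree r))"
    (is "_ = signed_sum _ ?P * signed_sum _ ?Q - _")
proof -
  let ?t = "\<langle>l, x, r\<rangle>" and ?D = "set_tree l \<union> set_tree r"
  have lr: "\<forall>y\<in>set_tree l. y < x" "\<forall>y\<in>set_tree r. x < y" using assms by auto
  have disj: "set_tree l \<inter> set_tree r = {}" using lr by fastforce
  have x: "x \<notin> ?D" using lr by auto
  have set: "set_tree ?t = insert x ?D" by auto
  have "signed_sum (set_tree ?t) (\<lambda>L. compat \<kappa> L ?t) =
      signed_sum ?D (\<lambda>L. compat \<kappa> L ?t) - signed_sum ?D (\<lambda>L. compat \<kappa> (insert x L) ?t)"
    unfolding set using x by (intro signed_sum_insert) auto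
  also have "signed_sum ?D (\<lambda>L. compat \<kappa> L ?t) =
      signed_sum ?D (\<lambda>L. ?P (L \<inter> set_tree l) \<and> ?Q (L \<inter> set_tree r))"
  proof (rule signed_sum_cong)
    fix L assume "L \<subseteq> ?D"
    \<comment> \<open>Without the root in \<open>L\<close>, the node condition at \<open>x\<close>
      separates into one condition per subtree.\<close>
    then have "x \<notin> L" using x by auto
    then show "compat \<kappa> L ?t = (?P (L \<inter> set_tree l) \<and> ?Q (L \<inter> set_tree r))"
      using value_in_set_tree[of l] value_in_set_tree[of r]
      by (auto simp: compat_node_def compat_Int)
  qed simp
  also have "\<dots> = signed_sum (set_tree l) ?P * signed_sum (set_tree r) ?Q"
    using disj by (intro signed_sum_Un) auto
  also have "signed_sum ?D (\<lambda>L. compat \<kappa> (insert x L) ?t) =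
      signed_sum ?D (\<lambda>L. L = ?D \<and> full \<kappa> ?t)"
  proof (rule signed_sum_cong)
    fix L assume L: "L \<subseteq> ?D"
    have "compat \<kappa> (insert x L) ?t \<longleftrightarrow> insert x L = set_tree ?t \<and> full \<kappa> ?t"
      using compat_root_iff[of ?t "insert x L" \<kappa>] L unfolding set by auto
    also have "insert x L = set_tree ?t \<longleftrightarrow> L = ?D" unfolding set using x L by (intro insert_ident) auto
    finally show "compat \<kappa> (insert x L) ?t = (L = ?D \<and> full \<kappa> ?t)" .
  qed simp
  also have "\<dots> = of_bool (full \<kappa> ?t) * (-1) ^ card ?D"
    by (rule signed_sum_whole) simp
  also have "card ?D = card (set_tree l) + card (set_tree r)"
    using disj by (intro card_Un_disjoint) auto
  finally show ?thesis .
qed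

text \<open>Interval label sets pass to the subtrees, which lets the induction run. By
  \<open>signed_sum_child\<close> each subtree contributes a \<open>good\<close> or a signed
  \<open>full\<close> indicator according to its edge: two \<open>good\<close> factors give the
  result, two \<open>full\<close> factors cancel against the root term, and mixed products
  vanish.\<close>

lemma signed_sum_compat_tree:
  "bst t \<Longrightarrow> set_tree t = {a..b} \<Longrightarrow>
    signed_sum (set_tree t) (\<lambda>L. compat \<kappa> L t) = of_bool (good \<kappa> t)"
proof (induction t arbitrary: a b)
  case Leaf
  then show ?case by (simp add: signed_sum_def)
next
  case (Node l x r)
  note ch = bst_interval_children[OF Node.prems]
  have bst: "bst l" "bst r" using Node.prems(1) by auto
  note IH = Node.IH(1)[OF bst(1) ch(1)] Node.IH(2)[OF bst(2) ch(2)]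
  have hd_l: "hd (inorder l) = a" if "l \<noteq> \<langle>\<rangle>"
    by (rule bst_interval_hd_inorder[OF bst(1) ch(1) that])
  have hd_r: "hd (inorder r) = x + 1" if "r \<noteq> \<langle>\<rangle>"
    by (rule bst_interval_hd_inorder[OF bst(2) ch(2) that])
  have hd: "hd (inorder \<langle>l, x, r\<rangle>) = a"
    by (rule bst_interval_hd_inorder[OF Node.prems]) simp
  have hd_leaf: "a = x" if "l = \<langle>\<rangle>" using hd that by simp
  have a: "a \<le> x" using Node.prems(2) by (metis atLeastAtMost_iff tree.set_intros(2))
  have gl: "int (\<kappa> (value l)) \<le> a" if "good \<kappa> l" "l \<noteq> \<langle>\<rangle>" using good_root_le[OF that] hd_l that by simp
  have gr: "int (\<kappa> (value r)) \<le> x + 1" if "good \<kappa> r" "r \<noteq> \<langle>\<rangle>" using good_root_le[OF that] hd_r that by simp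
  have fl: "x - 1 < int (\<kappa> (value l))" if "full \<kappa> l" "l \<noteq> \<langle>\<rangle>"
    by (rule full_root_gt[OF that(1) bst(1) ch(1) that(2)])
  have fl': "a < int (\<kappa> (value l))" if "full \<kappa> l" "l \<noteq> \<langle>\<rangle>" using full_root_gt_hd[OF that] hd_l that by simp
  have fr: "x + 1 < int (\<kappa> (value r))" if "full \<kappa> r" "r \<noteq> \<langle>\<rangle>" using full_root_gt_hd[OF that] hd_r that by simp
  define p q where "p \<longleftrightarrow> \<kappa> x \<le> \<kappa> (value l)" and "q \<longleftrightarrow> \<kappa> x < \<kappa> (value r)"
  have good: "good \<kappa> \<langle>l, x, r\<rangle> \<longleftrightarrow>
      int (\<kappa> x) \<le> a \<and> (l \<noteq> \<langle>\<rangle> \<longrightarrow> p) \<and> (r \<noteq> \<langle>\<rangle> \<longrightarrow> q) \<and> good \<kappa> l \<and> good \<kappa> r"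
    by (auto simp: good_node_def hd p_def q_def simp del: inorder.simps)
  have full: "full \<kappa> \<langle>l, x, r\<rangle> \<longleftrightarrow>
      int (\<kappa> x) > a \<and> (l \<noteq> \<langle>\<rangle> \<longrightarrow> \<not> p) \<and> (r \<noteq> \<langle>\<rangle> \<longrightarrow> \<not> q) \<and> full \<kappa> l \<and> full \<kappa> r"
    by (auto simp: full_node_def hd p_def q_def simp del: inorder.simps)
  note sum = signed_sum_Node[OF Node.prems(1), of \<kappa>, folded p_def q_def,
      unfolded signed_sum_child[OF IH(1)] signed_sum_child[OF IH(2)] good full]
  \<comment> \<open>A missing child fits both directions, since \<open>good\<close> and
    \<open>full\<close> hold for the empty tree; a single node is therefore a case of its
    own.\<close>
  consider (leaves) "l = \<langle>\<rangle>" "r = \<langle>\<rangle>"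
    | (up) "l \<noteq> \<langle>\<rangle> \<or> r \<noteq> \<langle>\<rangle>" "l = \<langle>\<rangle> \<or> p" "r = \<langle>\<rangle> \<or> q"
    | (down) "l \<noteq> \<langle>\<rangle> \<or> r \<noteq> \<langle>\<rangle>" "l = \<langle>\<rangle> \<or> \<not> p" "r = \<langle>\<rangle> \<or> \<not> q"
    | (up_down) "l \<noteq> \<langle>\<rangle>" "p" "r \<noteq> \<langle>\<rangle>" "\<not> q"
    | (down_up) "l \<noteq> \<langle>\<rangle>" "\<not> p" "r \<noteq> \<langle>\<rangle>" "q"
    by blast
  then show ?case
  proof cases
    case leaves
    \<comment> \<open>The empty ideal gives 1, and the ideal of the single node subtracts the
      indicator of \<open>a < int (\<kappa> x)\<close>.\<close>
    then show ?thesis unfolding sum good by auto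
  next
    case up
    \<comment> \<open>The bound at the root is automatic:
      \<open>\<kappa> x \<le> \<kappa> (value l) \<le> a\<close>, or, without a left child,
      \<open>\<kappa> x < \<kappa> (value r) \<le> x + 1\<close> and \<open>a = x\<close>.\<close>
    have "int (\<kappa> x) \<le> a" if "good \<kappa> l" "good \<kappa> r"
    proof (cases "l = \<langle>\<rangle>")
      case True
      then show ?thesis using up gr[OF that(2)] hd_leaf by (auto simp: q_def)
    next
      case False
      then show ?thesis using up gl[OF that(1)] by (auto simp: p_def)
    qed
    then show ?thesis unfolding sum good using up by auto
  next
    case down
    \<comment> \<open>Dually, the lower bound at the root follows from that of a child, so the root
      term equals the product of the subtree terms and cancels it.\<close>
    have "a < int (\<kappa> x)" if "full \<kappa> l" "full \<kappa> r"
    proof (cases "l = \<langle>\<rangle>")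
      case True
      then show ?thesis using down fr[OF that(2)] hd_leaf by (auto simp: q_def)
    next
      case False
      then show ?thesis using down fl'[OF that(1)] by (auto simp: p_def)
    qed
    then have "(a < int (\<kappa> x) \<and> full \<kappa> l \<and> full \<kappa> r) = (full \<kappa> l \<and> full \<kappa> r)" by blast
    then show ?thesis unfolding sum good using down
      by (cases "l = \<langle>\<rangle>"; cases "r = \<langle>\<rangle>") (simp_all add: of_bool_conj power_add)
  next
    case up_down
    \<comment> \<open>Otherwise \<open>\<kappa> x \<le> \<kappa> (value l) \<le> a \<le> x\<close>,
      while \<open>x + 1 < \<kappa> (value r) \<le> \<kappa> x\<close>.\<close>
    have "\<not> (good \<kappa> l \<and> full \<kappa> r)"
      using up_down gl fr a by (auto simp: p_def q_def)
    then show ?thesis unfolding sum good using up_down by auto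
  next
    case down_up
    \<comment> \<open>This is where the bound by the largest label enters:
      \<open>x - 1 < \<kappa> (value l) < \<kappa> x\<close> contradicts
      \<open>\<kappa> x < \<kappa> (value r) \<le> x + 1\<close>.\<close>
    have "\<not> (full \<kappa> l \<and> good \<kappa> r)"
      using down_up fl gr by (auto simp: p_def q_def)
    then show ?thesis unfolding sum good using down_up by auto
  qed
qed

section \<open>Forests\<close>

text \<open>The order on the trees makes their node sets disjoint, so the signed sum is a product of
  indicators.\<close>

lemma signed_sum_forest:
  assumes "\<And>t. t \<in> set F \<Longrightarrow>
      signed_sum (set_tree t) (\<lambda>L. compat \<kappa> L t) = of_bool (good \<kappa> t)"
    and "sorted_wrt (\<lambda>s t. \<forall>a \<in> set_tree s. \<forall>b \<in> set_tree t. a < b) F"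
  shows "signed_sum (IN F) (\<lambda>L. \<forall>t\<in>set F. compat \<kappa> L t) = of_bool (\<forall>t\<in>set F. good \<kappa> t)"
  using assms
proof (induction F)
  case Nil
  then show ?case by (simp add: IN_def signed_sum_def)
next
  case (Cons t F)
  have disj: "set_tree t \<inter> IN F = {}" using Cons.prems(2) by (fastforce simp: IN_def)
  have "signed_sum (IN (t # F)) (\<lambda>L. \<forall>s\<in>set (t # F). compat \<kappa> L s) =
      signed_sum (set_tree t \<union> IN F)
        (\<lambda>L. compat \<kappa> (L \<inter> set_tree t) t \<and> (\<forall>s\<in>set F. compat \<kappa> (L \<inter> IN F) s))"
  proof (rule signed_sum_cong)
    have "compat \<kappa> (L \<inter> IN F) s = compat \<kappa> L s" if "s \<in> set F" for s L
      using that by (intro compat_Int) (auto simp: IN_def)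
    then show "(\<forall>s\<in>set (t # F). compat \<kappa> L s) \<longleftrightarrow>
        compat \<kappa> (L \<inter> set_tree t) t \<and> (\<forall>s\<in>set F. compat \<kappa> (L \<inter> IN F) s)" for L
      by (simp add: compat_Int)
  qed (simp add: IN_def)
  also have "\<dots> = signed_sum (set_tree t) (\<lambda>L. compat \<kappa> L t) *
      signed_sum (IN F) (\<lambda>L. \<forall>s\<in>set F. compat \<kappa> L s)"
    using disj by (intro signed_sum_Un) (auto simp: finite_IN)
  also have "\<dots> = of_bool (\<forall>s\<in>set (t # F). good \<kappa> s)"
    using Cons by simp
  finally show ?case .
qed

section \<open>Subtree description of children, \<open>rho\<close> and the labelings\<close>

lemma subtrees_trans: "s \<in> subtrees t \<Longrightarrow> u \<in> subtrees s \<Longrightarrow> u \<in> subtrees t"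
  by (induction t) auto

text \<open>Each left step keeps the first inorder entry of the subtree, and the descent stops
  exactly there; \<open>rho_unique\<close> then evaluates the definite description.\<close>

lemma rho_eq_hd_inorder:
  assumes F: "indexed_forest S F" and t: "t \<in> set F" and "\<langle>l, v, r\<rangle> \<in> subtrees t"
  shows "rho F v = hd (inorder \<langle>l, v, r\<rangle>)"
proof -
  have *: "(left_child F)\<^sup>*\<^sup>* (hd (inorder \<langle>l, v, r\<rangle>)) v \<and> (\<nexists>u. left_child F u (hd (inorder \<langle>l, v, r\<rangle>)))"
    using assms(3)
  proof (induction l arbitrary: v r)
    case Leaf
    have "\<nexists>u. left_child F u v"
      using indexed_forest_node_unique[OF F t _ Leaf] unfolding left_child_def by blast
    then show ?case by simp
  next
    case (Node l' w r')
    have w: "left_child F w v" using Node.prems t unfolding left_child_def by blast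
    have "\<langle>l', w, r'\<rangle> \<in> subtrees t" by (rule subtrees_trans[OF Node.prems]) simp
    from Node.IH(1)[OF this] w show ?case
      unfolding hd_inorder_Node[of "\<langle>l', w, r'\<rangle>"] by (auto intro: rtranclp.rtrancl_into_rtrancl)
  qed
  have "v \<in> IN F" using assms by (auto simp: IN_def dest: in_set_tree_if)
  from the1_equality[OF rho_unique[OF F this] *] show ?thesis unfolding rho_def .
qed

lemma left_child_value:
  "t \<in> set F \<Longrightarrow> \<langle>l, u, r\<rangle> \<in> subtrees t \<Longrightarrow> l \<noteq> \<langle>\<rangle> \<Longrightarrow> left_child F (value l) u"
  unfolding left_child_def by (cases l) auto

lemma right_child_value:
  "t \<in> set F \<Longrightarrow> \<langle>l, u, r\<rangle> \<in> subtrees t \<Longrightarrow> r \<noteq> \<langle>\<rangle> \<Longrightarrow> right_child F (value r) u"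
  unfolding right_child_def by (cases r) auto

lemma left_childE:
  assumes "left_child F v u"
  obtains t l r where "t \<in> set F" "\<langle>l, u, r\<rangle> \<in> subtrees t" "l \<noteq> \<langle>\<rangle>" "value l = v"
  using assms unfolding left_child_def by fastforce

lemma right_childE:
  assumes "right_child F v u"
  obtains t l r where "t \<in> set F" "\<langle>l, u, r\<rangle> \<in> subtrees t" "r \<noteq> \<langle>\<rangle>" "value r = v"
  using assms unfolding right_child_def by fastforce

lemma in_IN_E:
  assumes "v \<in> IN F"
  obtains t l r where "t \<in> set F" "\<langle>l, v, r\<rangle> \<in> subtrees t"
  using assms unfolding IN_def using set_treeE by fastforce

lemma subtree_root_in_IN: "t \<in> set F \<Longrightarrow> \<langle>l, v, r\<rangle> \<in> subtrees t \<Longrightarrow> v \<in> IN F"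
  by (auto simp: IN_def dest: in_set_tree_if)

lemma left_child_in_IN: "left_child F v u \<Longrightarrow> v \<in> IN F \<and> u \<in> IN F"
proof -
  assume "left_child F v u"
  then obtain t l r r' where t: "t \<in> set F" "\<langle>\<langle>l, v, r\<rangle>, u, r'\<rangle> \<in> subtrees t"
    unfolding left_child_def by blast
  have "\<langle>l, v, r\<rangle> \<in> subtrees t" by (rule subtrees_trans[OF t(2)]) simp
  then show ?thesis using t subtree_root_in_IN by blast
qed

lemma right_child_in_IN: "right_child F v u \<Longrightarrow> v \<in> IN F \<and> u \<in> IN F"
proof -
  assume "right_child F v u"
  then obtain t l r l' where t: "t \<in> set F" "\<langle>l', u, \<langle>l, v, r\<rangle>\<rangle> \<in> subtrees t"
    unfolding right_child_def by blast
  have "\<langle>l, v, r\<rangle> \<in> subtrees t" by (rule subtrees_trans[OF t(2)]) simp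
  then show ?thesis using t subtree_root_in_IN by blast
qed

lemma forest_labelings_iff_good:
  assumes F: "indexed_forest S F" and \<kappa>: "\<kappa> \<in> IN F \<rightarrow>\<^sub>E {1..}"
  shows "\<kappa> \<in> forest_labelings F \<longleftrightarrow> (\<forall>t\<in>set F. good \<kappa> t)"
proof
  assume "\<kappa> \<in> forest_labelings F"
  then have K: "\<forall>v\<in>IN F. int (\<kappa> v) \<le> rho F v" "\<forall>u v. left_child F v u \<longrightarrow> \<kappa> v \<ge> \<kappa> u"
    "\<forall>u v. right_child F v u \<longrightarrow> \<kappa> v > \<kappa> u"
    by (auto simp: forest_labelings_def)
  show "\<forall>t\<in>set F. good \<kappa> t"
    unfolding good_iff_subtrees good_node_def
    using K rho_eq_hd_inorder[OF F] subtree_root_in_IN left_child_value right_child_value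
    by metis
next
  assume "\<forall>t\<in>set F. good \<kappa> t"
  then have good: "good_node \<kappa> l a r" if "t \<in> set F" "\<langle>l, a, r\<rangle> \<in> subtrees t" for t l a r
    using that good_iff_subtrees by blast
  have "int (\<kappa> v) \<le> rho F v" if "v \<in> IN F" for v
    using that by (rule in_IN_E) (metis good good_node_def rho_eq_hd_inorder[OF F])
  moreover have "\<kappa> v \<ge> \<kappa> u" if "left_child F v u" for u v
    using that by (rule left_childE) (metis good good_node_def)
  moreover have "\<kappa> v > \<kappa> u" if "right_child F v u" for u v
    using that by (rule right_childE) (metis good good_node_def)
  ultimately show "\<kappa> \<in> forest_labelings F" using \<kappa> by (simp add: forest_labelings_def)
qed

lemma compatible_labelings_iff_compat:
  assumes F: "indexed_forest S F" and \<kappa>: "\<kappa> \<in> IN F \<rightarrow>\<^sub>E {1..}" and L: "L \<subseteq> IN F"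
  shows "lower_order_ideal F L \<and> \<kappa> \<in> compatible_labelings F L \<longleftrightarrow> (\<forall>t\<in>set F. compat \<kappa> L t)"
proof
  assume asm: "lower_order_ideal F L \<and> \<kappa> \<in> compatible_labelings F L"
  have ideal: "v \<in> L" if "u \<in> L" "left_child F v u \<or> right_child F v u" for u v
    using asm that unfolding lower_order_ideal_def by blast
  \<comment> \<open>The definition quantifies over \<open>IN F - L\<close>; both ends of an edge lie
    in \<open>IN F\<close>, so being outside \<open>L\<close> suffices.\<close>
  have up: "(left_child F v u \<longrightarrow> \<kappa> u \<le> \<kappa> v) \<and> (right_child F v u \<longrightarrow> \<kappa> u < \<kappa> v)"
    if "u \<notin> L" "v \<notin> L" for u v
    using asm that left_child_in_IN right_child_in_IN unfolding compatible_labelings_def by blast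
  have down: "(left_child F v u \<longrightarrow> \<kappa> v < \<kappa> u) \<and> (right_child F v u \<longrightarrow> \<kappa> v \<le> \<kappa> u)"
    if "u \<in> L" "v \<in> L" for u v
    using asm that unfolding compatible_labelings_def by blast
  have rho: "rho F v < int (\<kappa> v)" if "v \<in> L" for v
    using asm that unfolding compatible_labelings_def by blast
  show "\<forall>t\<in>set F. compat \<kappa> L t"
    unfolding compat_iff_subtrees
  proof (intro ballI allI impI)
    fix t l a r assume t: "t \<in> set F" "\<langle>l, a, r\<rangle> \<in> subtrees t"
    show "compat_node \<kappa> L l a r"
      unfolding compat_node_def full_node_def rho_eq_hd_inorder[OF F t, symmetric]
      using left_child_value[OF t] right_child_value[OF t] ideal[of a] up[of a] down[of a] rho[of a]
      by (auto)
  qed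
next
  assume "\<forall>t\<in>set F. compat \<kappa> L t"
  then have compat: "compat_node \<kappa> L l a r" if "t \<in> set F" "\<langle>l, a, r\<rangle> \<in> subtrees t" for t l a r
    using that compat_iff_subtrees by blast
  \<comment> \<open>A child in \<open>L\<close> below a parent outside \<open>L\<close> puts no
    condition on the edge, hence the disjunction.\<close>
  have left: "if u \<in> L then v \<in> L \<and> \<kappa> v < \<kappa> u else v \<in> L \<or> \<kappa> u \<le> \<kappa> v"
    if "left_child F v u" for u v
    using that by (rule left_childE) (use compat in \<open>fastforce simp: compat_node_def full_node_def\<close>)
  have right: "if u \<in> L then v \<in> L \<and> \<kappa> v \<le> \<kappa> u else v \<in> L \<or> \<kappa> u < \<kappa> v"
    if "right_child F v u" for u v
    using that by (rule right_childE) (use compat in \<open>fastforce simp: compat_node_def full_node_def\<close>)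
  have rho: "rho F v < int (\<kappa> v)" if v: "v \<in> L" for v
  proof -
    obtain t l r where t: "t \<in> set F" "\<langle>l, v, r\<rangle> \<in> subtrees t"
      using in_IN_E[of v F] L v by blast
    then show ?thesis
      using compat[OF t] v rho_eq_hd_inorder[OF F t] by (simp add: compat_node_def full_node_def)
  qed
  have "lower_order_ideal F L"
    unfolding lower_order_ideal_def using L left right by metis
  moreover have "\<kappa> \<in> compatible_labelings F L"
    unfolding compatible_labelings_def using \<kappa> left right rho
    by (intro CollectI conjI ballI impI) (force split: if_splits)+
  ultimately show "lower_order_ideal F L \<and> \<kappa> \<in> compatible_labelings F L" ..
qed

text \<open>The identity for one fixed labeling, to be summed over all labelings with a given
  monomial.\<close>

lemma signed_count_compatible:
  assumes F: "indexed_forest S F" and \<kappa>: "\<kappa> \<in> IN F \<rightarrow>\<^sub>E {1..}"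
  shows "(\<Sum>L | lower_order_ideal F L. (-1) ^ card L * of_bool (\<kappa> \<in> compatible_labelings F L)) =
    (of_bool (\<kappa> \<in> forest_labelings F) :: rat)"
proof -
  have tree: "signed_sum (set_tree t) (\<lambda>L. compat \<kappa> L t) = of_bool (good \<kappa> t)" if "t \<in> set F" for t
  proof -
    \<comment> \<open>Canonical labels increase in inorder, so each tree is a search tree; its label
      set is a block, hence an interval.\<close>
    have "bst t" using F that by (simp add: indexed_forest_def bst_iff_sorted_wrt_less)
    moreover have "set_tree t \<in> blocks S" using F that by (auto simp: indexed_forest_def)
    then obtain a b where "set_tree t = {a..b}" by (auto simp: blocks_def)
    ultimately show ?thesis by (rule signed_sum_compat_tree)
  qed
  have "(\<Sum>L | lower_order_ideal F L. (-1) ^ card L * of_bool (\<kappa> \<in> compatible_labelings F L)) =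
      signed_sum (IN F) (\<lambda>L. lower_order_ideal F L \<and> \<kappa> \<in> compatible_labelings F L)"
    unfolding signed_sum_def
  \<comment> \<open>Subsets that are not ideals contribute zero, so the range extends to all
    subsets.\<close>
  proof (rule sum.mono_neutral_cong_left)
    show "{L. lower_order_ideal F L} \<subseteq> Pow (IN F)" by (auto simp: lower_order_ideal_def)
  qed (simp_all add: finite_IN)
  also have "\<dots> = signed_sum (IN F) (\<lambda>L. \<forall>t\<in>set F. compat \<kappa> L t)"
    using compatible_labelings_iff_compat[OF F \<kappa>] by (intro signed_sum_cong) auto
  also have "\<dots> = of_bool (\<forall>t\<in>set F. good \<kappa> t)"
    using F by (intro signed_sum_forest tree) (auto simp: indexed_forest_def)
  finally show ?thesis unfolding forest_labelings_iff_good[OF F \<kappa>] .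
qed

section \<open>Comparison of coefficients\<close>

lemma mcoeff_sum: "mcoeff (sum f A) m = (\<Sum>x\<in>A. mcoeff (f x) m)"
  by (induction A rule: infinite_finite_induct) (auto simp: zero_mfps.rep_eq plus_mfps.rep_eq)

lemma mcoeff_neg_one_power_mult:
  "mcoeff ((-1) ^ n * f) m = (-1) ^ n * mcoeff f m"
  by (cases "even n") (auto simp: uminus_mfps.rep_eq)

lemma mcoeff_formal_sum:
  "mcoeff (formal_sum f A) m = (\<Sum>k \<in> {k \<in> A. mcoeff (f k) m \<noteq> 0}. mcoeff (f k) m)"
  by (simp add: formal_sum_def Abs_mfps_inverse)

theorem theorem4p2:
  fixes S :: "int set" and F :: "int tree list"
  assumes "indexed_forest S F"
  shows "forest_polynomial F =
    (\<Sum>L | lower_order_ideal F L.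
       (-1) ^ card L *
       formal_sum (\<lambda>\<kappa>. \<Prod>v \<in> IN F. mfps_var (\<kappa> v)) (compatible_labelings F L))"
proof (rule mfps_eqI)
  fix m :: "nat multiset"
  \<comment> \<open>Only labelings with monomial \<open>m\<close> matter. Their values lie in
    \<open>set_mset m\<close>, so \<open>K\<close> is finite.\<close>
  define K where "K = {\<kappa> \<in> IN F \<rightarrow>\<^sub>E {1..}. m = image_mset \<kappa> (mset_set (IN F))}"
  have "K \<subseteq> IN F \<rightarrow>\<^sub>E set_mset m"
    by (auto simp: K_def finite_IN)
  then have finK: "finite K"
    by (rule finite_subset) (simp add: finite_PiE finite_IN)
  note mc = mcoeff_prod_var[OF finite_IN]
  \<comment> \<open>A labeling contributes 1 to the coefficient of its own monomial and 0 to all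
    others, so the formal sum becomes a count over \<open>K\<close>.\<close>
  have coeff: "mcoeff (formal_sum (\<lambda>\<kappa>. \<Prod>v \<in> IN F. mfps_var (\<kappa> v)) (compatible_labelings F L)) m =
      (\<Sum>\<kappa>\<in>K. of_bool (\<kappa> \<in> compatible_labelings F L) :: rat)" for L
    unfolding mcoeff_formal_sum mc
    by (intro sum.mono_neutral_cong_left finK) (auto simp: K_def compatible_labelings_def split: if_splits)
  have "mcoeff (forest_polynomial F) m = (\<Sum>\<kappa>\<in>K. of_bool (\<kappa> \<in> forest_labelings F))"
    unfolding forest_polynomial_def mcoeff_sum mc
    by (rule sum.mono_neutral_cong[OF finK finite_forest_labelings])
       (auto simp: K_def forest_labelings_def)
  also have "\<dots> = (\<Sum>\<kappa>\<in>K. \<Sum>L | lower_order_ideal F L.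
      (-1) ^ card L * of_bool (\<kappa> \<in> compatible_labelings F L))"
    by (intro sum.cong refl signed_count_compatible[OF assms, symmetric]) (simp add: K_def)
  also have "\<dots> = (\<Sum>L | lower_order_ideal F L. (-1) ^ card L *
      (\<Sum>\<kappa>\<in>K. of_bool (\<kappa> \<in> compatible_labelings F L)))"
    by (subst sum.swap) (simp add: sum_distrib_left)
  also have "\<dots> = mcoeff (\<Sum>L | lower_order_ideal F L. (-1) ^ card L *
      formal_sum (\<lambda>\<kappa>. \<Prod>v \<in> IN F. mfps_var (\<kappa> v)) (compatible_labelings F L)) m"
    unfolding mcoeff_sum mcoeff_neg_one_power_mult coeff ..
  finally show "mcoeff (forest_polynomial F) m = \<dots>" .
qed

end
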